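(* Suppose there is an RGR$(k,L)$. Then there exists a cyclic resolvable $(kw,k)$-configuration for every positive integer $w$ with $kw \geq 2L+1$.
   Context: A Golomb ruler of order $k$ is a set of $k$ distinct integers $x_1<x_2<\cdots<x_k$ such that all the differences $x_j-x_i$ ($i\neq j$) are distinct; its length is $x_k-x_1$. It is resolvable if $x_j-x_i\not\equiv 0 \bmod k$ for all $i\neq j$ (equivalently, its elements cover all $k$ residue classes modulo $k$). An RGR$(k,L)$ is a resolvable Golomb ruler of order $k$ and length $L$. A $(v,k)$-configuration is a pair $(V,\mathcal{B})$, where $V$ is a set of $v$ points and $\mathcal{B}$ is a set of exactly $v$ blocks (subsets of $V$), each containing exactly $k$ points, such that no pair of distinct points occurs in more than one block and every point occurs in exactly $k$ blocks. When $v \equiv 0 \bmod k$, a resolvable $(v,k)$-configuration is a triple $(V,\mathcal{B},\mathcal{R})$ where $(V,\mathcal{B})$ is a $(v,k)$-configuration and $\mathcal{R}$ (the resolution) is a partition of $\mathcal{B}$ into $k$ parallel classes, each consisting of $v/k$ blocks that partition $V$. A resolvable $(v,k)$-configuration is cyclic if, up to isomorphism, $V=\mathbb{Z}_v$ and $\mathcal{R}$ is invariant under the action $x \mapsto x+1 \pmod v$. *)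

theory Defs
  imports Complex_Main "HOL-Number_Theory.Cong" "HOL-Library.Disjoint_Sets"
begin

text \<open>The ruler \<open>x\<^sub>1 < \<dots> < x\<^sub>k\<close> is represented by its set of marks. The order is positive,
  so that the length \<open>x\<^sub>k - x\<^sub>1\<close> makes sense. Differences of ordered pairs are compared,
  so both signs are included.\<close>

definition golomb_ruler :: "nat \<Rightarrow> int set \<Rightarrow> bool" where
  "golomb_ruler k X \<longleftrightarrow>
     0 < k \<and> finite X \<and> card X = k \<and>
     inj_on (\<lambda>(x, y). y - x) {(x, y). x \<in> X \<and> y \<in> X \<and> x \<noteq> y}"

definition ruler_length :: "int set \<Rightarrow> int" where
  "ruler_length X = Max X - Min X"

definition resolvable_ruler :: "nat \<Rightarrow> int set \<Rightarrow> bool" where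
  "resolvable_ruler k X \<longleftrightarrow>
     (\<forall>x\<in>X. \<forall>y\<in>X. x \<noteq> y \<longrightarrow> \<not> [y - x = 0] (mod int k))"

definition RGR :: "nat \<Rightarrow> nat \<Rightarrow> int set \<Rightarrow> bool" where
  "RGR k L X \<longleftrightarrow>
     golomb_ruler k X \<and> resolvable_ruler k X \<and> ruler_length X = int L"

definition configuration :: "nat \<Rightarrow> nat \<Rightarrow> 'a set \<Rightarrow> 'a set set \<Rightarrow> bool" where
  "configuration v k V \<B> \<longleftrightarrow>
     finite V \<and> card V = v \<and>
     \<B> \<subseteq> Pow V \<and> card \<B> = v \<and>
     (\<forall>B\<in>\<B>. card B = k) \<and>
     (\<forall>x\<in>V. \<forall>y\<in>V. x \<noteq> y \<longrightarrow> card {B \<in> \<B>. x \<in> B \<and> y \<in> B} \<le> 1) \<and>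
     (\<forall>x\<in>V. card {B \<in> \<B>. x \<in> B} = k)"

definition resolvable_configuration ::
  "nat \<Rightarrow> nat \<Rightarrow> 'a set \<Rightarrow> 'a set set \<Rightarrow> 'a set set set \<Rightarrow> bool" where
  "resolvable_configuration v k V \<B> \<R> \<longleftrightarrow>
     k dvd v \<and> configuration v k V \<B> \<and>
     partition_on \<B> \<R> \<and> card \<R> = k \<and>
     (\<forall>P\<in>\<R>. card P = v div k \<and> partition_on V P)"

text \<open>\<open>\<int>\<^sub>v\<close> is represented by the residues \<open>{0..<v}\<close>, and \<open>f\<close> is the isomorphism identifying the
  point set with it. Each of \<open>f\<close> and the translation acts on a resolution, a set of sets of
  blocks, by a threefold image. Invariance of the blocks follows, as \<open>\<B> = \<Union>\<R>\<close>.\<close>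

definition cyclic_resolvable_configuration ::
  "nat \<Rightarrow> nat \<Rightarrow> 'a set \<Rightarrow> 'a set set \<Rightarrow> 'a set set set \<Rightarrow> bool" where
  "cyclic_resolvable_configuration v k V \<B> \<R> \<longleftrightarrow>
     resolvable_configuration v k V \<B> \<R> \<and>
     (\<exists>f. bij_betw f V {0..<int v} \<and>
          (let \<R>' = (`) ((`) ((`) f)) \<R>
           in (`) ((`) ((`) (\<lambda>x. (x + 1) mod int v))) \<R>' = \<R>'))"

end

theory Submission
  imports Defs
begin

text \<open>
  Let \<open>v = kw\<close> and let \<open>X\<close> be the ruler. The blocks are the translates \<open>X + i\<close> of \<open>X\<close> in
  \<open>\<int>\<^sub>v\<close>, and the parallel class with index \<open>j\<close> consists of those \<open>X + i\<close> with \<open>i \<equiv> j (mod k)\<close>.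
  This makes sense because \<open>k\<close> divides \<open>v\<close>, and translation by \<open>1\<close> permutes the classes.

  The hypothesis \<open>v \<ge> 2L + 1\<close> enters in one place only: the differences of \<open>X\<close> lie in
  \<open>{-L..L}\<close>, an interval that embeds into \<open>\<int>\<^sub>v\<close>, so they stay distinct modulo \<open>v\<close>
  (\<open>Golomb_difference_mod_unique\<close>). If two points \<open>p \<noteq> q\<close> lie in a block \<open>X + i\<close>, then
  \<open>q - p\<close> is congruent to a difference of \<open>X\<close>; this difference determines the mark that is
  moved to \<open>p\<close>, and thus determines \<open>i\<close> (\<open>two_points_determine_shift\<close>).

  Resolvability says that \<open>X\<close> is a transversal of the residue classes modulo \<open>k\<close>. Given a point
  \<open>p\<close> and a class \<open>j\<close>, there is therefore exactly one mark \<open>x\<close> with \<open>p - x \<equiv> j (mod k)\<close>, and the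
  translate \<open>X + (p - x)\<close> is the only block of the class \<open>j\<close> through \<open>p\<close>
  (\<open>partition_on_parallel_class\<close>).
\<close>

section \<open>Differences of a ruler modulo a large number\<close>

text \<open>Two integers of absolute value at most \<open>L\<close> differ by less than \<open>2L + 1\<close>, so congruence
  modulo \<open>v\<close> makes them equal.\<close>

lemma Golomb_difference_mod_unique:
  fixes v :: int
  assumes "RGR k L X" and v: "2 * int L + 1 \<le> v"
    and X: "x \<in> X" "y \<in> X" "x' \<in> X" "y' \<in> X" and "x \<noteq> y"
    and cong: "[y - x = y' - x'] (mod v)"
  shows "x = x'"
proof -
  have fin: "finite X" and len: "Max X - Min X = int L"
    and inj: "inj_on (\<lambda>(x, y). y - x) {(x, y). x \<in> X \<and> y \<in> X \<and> x \<noteq> y}"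
    using assms(1) by (auto simp: RGR_def golomb_ruler_def ruler_length_def)
  have bound: "\<bar>b - a\<bar> \<le> int L" if "a \<in> X" "b \<in> X" for a b
    using Max_ge[OF fin that(1)] Max_ge[OF fin that(2)]
      Min_le[OF fin that(1)] Min_le[OF fin that(2)] len by linarith
  have "\<bar>(y - x) - (y' - x')\<bar> < v"
    using bound[OF X(1,2)] bound[OF X(3,4)] v by linarith
  moreover have "v dvd (y - x) - (y' - x')"
    using cong by (simp add: cong_iff_dvd_diff)
  ultimately have eq: "y - x = y' - x'"
    using zdvd_not_zless[of "\<bar>(y - x) - (y' - x')\<bar>" v] by auto
  with \<open>x \<noteq> y\<close> have "x' \<noteq> y'" by auto
  with inj_onD[OF inj, of "(x, y)" "(x', y')"] eq X \<open>x \<noteq> y\<close> show ?thesis by auto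
qed

section \<open>Residue classes inside an interval\<close>

lemma succ_mod_image:
  fixes n :: int
  assumes "0 < n"
  shows "(\<lambda>i. (i + 1) mod n) ` {0..<n} = {0..<n}"
proof (intro equalityI subsetI)
  fix i assume "i \<in> {0..<n}"
  then have "i = ((i - 1) mod n + 1) mod n" by (simp add: mod_simps)
  moreover have "(i - 1) mod n \<in> {0..<n}" using assms by simp
  ultimately show "i \<in> (\<lambda>i. (i + 1) mod n) ` {0..<n}" by blast
qed (use assms in auto)

definition residue_class :: "nat \<Rightarrow> int \<Rightarrow> int \<Rightarrow> int set" where
  "residue_class k v j = {i \<in> {0..<v}. i mod int k = j}"

lemma card_residue_class:
  assumes "0 < k" and j: "j \<in> {0..<int k}"
  shows "card (residue_class k (int (k * w)) j) = w"
proof -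
  have "bij_betw (\<lambda>t. int k * t + j) {0..<int w} (residue_class k (int (k * w)) j)"
  proof (rule bij_betw_byWitness[where f' = "\<lambda>i. i div int k"])
    show "(\<lambda>t. int k * t + j) ` {0..<int w} \<subseteq> residue_class k (int (k * w)) j"
    proof clarify
      fix t assume t: "t \<in> {0..<int w}"
      have "int k * t + j < int k * (t + 1)" using j by (simp add: algebra_simps)
      also have "\<dots> \<le> int k * int w" using t by (intro mult_left_mono) auto
      finally show "int k * t + j \<in> residue_class k (int (k * w)) j"
        using t j by (simp add: residue_class_def)
    qed
    show "(\<lambda>i. i div int k) ` residue_class k (int (k * w)) j \<subseteq> {0..<int w}"
    proof clarify
      fix i assume "i \<in> residue_class k (int (k * w)) j"
      then have i: "0 \<le> i" "i < int k * int w" by (auto simp: residue_class_def)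
      have "int k * (i div int k) \<le> i"
        using mult_div_mod_eq[of "int k" i] pos_mod_sign[of "int k" i] \<open>0 < k\<close> by linarith
      then have "int k * (i div int k) < int k * int w" using i by linarith
      then show "i div int k \<in> {0..<int w}"
        using \<open>0 < k\<close> i by (simp add: pos_imp_zdiv_nonneg_iff)
    qed
  qed (use j in \<open>auto simp: residue_class_def\<close>)
  from bij_betw_same_card[OF this] show ?thesis by simp
qed

lemma succ_mod_image_residue_class:
  assumes "0 < k" "0 < v" "int k dvd v" and j: "j \<in> {0..<int k}"
  shows "(\<lambda>i. (i + 1) mod v) ` residue_class k v j = residue_class k v ((j + 1) mod int k)"
proof (intro equalityI subsetI)
  fix i assume i: "i \<in> residue_class k v ((j + 1) mod int k)"
  have "(i - 1) mod v mod int k = (i mod int k - 1) mod int k"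
    using \<open>int k dvd v\<close> by (simp add: mod_mod_cancel mod_simps)
  also have "\<dots> = j" using i j by (simp add: residue_class_def mod_simps)
  finally have "(i - 1) mod v \<in> residue_class k v j"
    using \<open>0 < v\<close> by (simp add: residue_class_def)
  moreover have "i = ((i - 1) mod v + 1) mod v"
    using i by (simp add: residue_class_def mod_simps)
  ultimately show "i \<in> (\<lambda>i. (i + 1) mod v) ` residue_class k v j" by blast
qed (use assms in \<open>auto simp: residue_class_def mod_mod_cancel mod_simps\<close>)

lemma partition_on_residue_classes:
  assumes "\<And>j. j \<in> {0..<int k} \<Longrightarrow> residue_class k v j \<noteq> {}" and "0 < k"
  shows "partition_on {0..<v} (residue_class k v ` {0..<int k})"
proof (rule partition_onI)
  show "\<Union> (residue_class k v ` {0..<int k}) = {0..<v}"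
    using \<open>0 < k\<close> by (auto simp: residue_class_def)
qed (use assms(1) in \<open>force simp: residue_class_def disjnt_def\<close>)+

section \<open>The translates of a modular ruler\<close>

text \<open>The construction takes place in \<open>\<int>\<^sub>v\<close> and \<open>\<int>\<^sub>k\<close>, so the ruler is described by its
  behaviour modulo \<open>v = kw\<close> and modulo \<open>k\<close>.\<close>

locale modular_resolvable_ruler =
  fixes k w :: nat and X :: "int set"
  assumes k_pos: "0 < k" and w_pos: "0 < w"
    and finite_X: "finite X" and card_X: "card X = k"
    and difference_unique:
      "\<lbrakk>x \<in> X; y \<in> X; x' \<in> X; y' \<in> X; x \<noteq> y; [y - x = y' - x'] (mod int (k * w))\<rbrakk>
        \<Longrightarrow> x = x'"
    and marks_incongruent: "\<lbrakk>x \<in> X; y \<in> X; [x = y] (mod int k)\<rbrakk> \<Longrightarrow> x = y"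
begin

definition v :: int where "v = int (k * w)"

definition translate :: "int \<Rightarrow> int set" where
  "translate i = (\<lambda>x. (x + i) mod v) ` X"

definition parallel_class :: "int \<Rightarrow> int set set" where
  "parallel_class j = translate ` residue_class k v j"

definition blocks :: "int set set" where
  "blocks = translate ` {0..<v}"

definition resolution :: "int set set set" where
  "resolution = parallel_class ` {0..<int k}"

lemma v_pos: "0 < v"
  using k_pos w_pos by (simp add: v_def)

lemma k_dvd_v: "int k dvd v"
  by (simp add: v_def)

lemma cong_v_imp_cong_k: "[a = b] (mod v) \<Longrightarrow> [a = b] (mod int k)"
  using k_dvd_v cong_dvd_modulus by blast

lemma X_nonempty: "X \<noteq> {}"
  using card_X k_pos by auto

lemma cong_v_imp_eq: "\<lbrakk>i \<in> {0..<v}; j \<in> {0..<v}; [i = j] (mod v)\<rbrakk> \<Longrightarrow> i = j"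
  by (simp add: cong_def)

lemma translate_subset: "translate i \<subseteq> {0..<v}"
  using v_pos by (auto simp: translate_def)

lemma card_translate: "card (translate i) = k"
proof -
  have "inj_on (\<lambda>x. (x + i) mod v) X"
  proof (rule inj_onI)
    fix x y assume "x \<in> X" "y \<in> X" "(x + i) mod v = (y + i) mod v"
    then have "[x + i = y + i] (mod v)" by (simp add: cong_def)
    then have "[x = y] (mod v)" by (simp only: cong_add_rcancel)
    with \<open>x \<in> X\<close> \<open>y \<in> X\<close> show "x = y" using cong_v_imp_cong_k marks_incongruent by blast
  qed
  then show ?thesis by (simp add: translate_def card_image card_X)
qed

lemma mem_translateE:
  assumes "p \<in> translate i"
  obtains x where "x \<in> X" "[p = x + i] (mod v)"
  using assms by (auto simp: translate_def cong_def)

lemma mem_translateI: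
  assumes "p \<in> {0..<v}" "x \<in> X" "[p = x + i] (mod v)"
  shows "p \<in> translate i"
  using assms by (auto simp: translate_def cong_def)

text \<open>The difference \<open>q - p\<close> determines the mark that is moved to \<open>p\<close>, and with it the shift.\<close>

lemma two_points_determine_shift:
  assumes ij: "i \<in> {0..<v}" "j \<in> {0..<v}" and pq: "p \<in> {0..<v}" "q \<in> {0..<v}" "p \<noteq> q"
    and i: "p \<in> translate i" "q \<in> translate i" and j: "p \<in> translate j" "q \<in> translate j"
  shows "i = j"
proof -
  obtain x y where x: "x \<in> X" "[p = x + i] (mod v)" and y: "y \<in> X" "[q = y + i] (mod v)"
    using i by (metis mem_translateE)
  obtain x' y' where x': "x' \<in> X" "[p = x' + j] (mod v)" and y': "y' \<in> X" "[q = y' + j] (mod v)"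
    using j by (metis mem_translateE)
  have "x \<noteq> y"
    using cong_v_imp_eq[OF pq(1,2)] pq(3) x y by (metis cong_sym cong_trans)
  moreover have "[y - x = y' - x'] (mod v)"
    using cong_diff[OF y(2) x(2)] cong_diff[OF y'(2) x'(2)] by (simp add: cong_def)
  ultimately have "x = x'"
    using difference_unique x(1) y(1) x'(1) y'(1) unfolding v_def by blast
  then have "[x + i = x + j] (mod v)" using x x' by (metis cong_sym cong_trans)
  then have "[i = j] (mod v)" by (simp only: cong_add_lcancel)
  with ij show ?thesis by (rule cong_v_imp_eq)
qed

text \<open>A block with two points determines its shift. For \<open>k = 1\<close> the blocks are singletons and
  the shift is read off from the only point.\<close>

lemma inj_on_translate: "inj_on translate {0..<v}"
proof (rule inj_onI)
  fix i j assume ij: "i \<in> {0..<v}" "j \<in> {0..<v}" and eq: "translate i = translate j"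
  show "i = j"
  proof (cases "k = 1")
    case True
    then obtain x where X: "X = {x}" using card_X card_1_singletonE by blast
    then have "[x + i = x + j] (mod v)" using eq unfolding translate_def by (simp add: cong_def)
    then have "[i = j] (mod v)" by (simp only: cong_add_lcancel)
    with ij show ?thesis by (rule cong_v_imp_eq)
  next
    case False
    then have "\<not> card (translate i) \<le> Suc 0" using k_pos by (simp add: card_translate)
    moreover have "finite (translate i)" by (simp add: translate_def finite_X)
    ultimately obtain p q where "p \<in> translate i" "q \<in> translate i" "p \<noteq> q"
      by (auto simp: card_le_Suc0_iff_eq)
    with two_points_determine_shift[OF ij] eq translate_subset show ?thesis by blast
  qed
qed

text \<open>The shifts that put a given point \<open>p\<close> into the block are the \<open>p - x\<close> with \<open>x\<close> a mark.\<close>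

lemma card_shifts_through_point:
  assumes p: "p \<in> {0..<v}"
  shows "card {i \<in> {0..<v}. p \<in> translate i} = k"
proof -
  have "{i \<in> {0..<v}. p \<in> translate i} = (\<lambda>x. (p - x) mod v) ` X"
  proof (intro equalityI subsetI)
    fix i assume "i \<in> {i \<in> {0..<v}. p \<in> translate i}"
    then obtain x where x: "x \<in> X" "[p = x + i] (mod v)" and i: "i \<in> {0..<v}"
      by (auto elim: mem_translateE)
    have "[p - x = i] (mod v)" using cong_diff[OF x(2) cong_refl[of x]] by simp
    then have "i = (p - x) mod v" using i by (simp add: cong_def)
    with x(1) show "i \<in> (\<lambda>x. (p - x) mod v) ` X" by blast
  next
    fix i assume "i \<in> (\<lambda>x. (p - x) mod v) ` X"
    then obtain x where x: "x \<in> X" "i = (p - x) mod v" by blast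
    then have "[p = x + i] (mod v)" by (simp add: cong_def mod_simps)
    with p x v_pos show "i \<in> {i \<in> {0..<v}. p \<in> translate i}"
      by (auto intro: mem_translateI)
  qed
  moreover have "inj_on (\<lambda>x. (p - x) mod v) X"
  proof (rule inj_onI)
    fix x y assume xy: "x \<in> X" "y \<in> X" "(p - x) mod v = (p - y) mod v"
    then have "[p - x = p - y] (mod v)" by (simp add: cong_def)
    from cong_diff[OF cong_refl[of p] this] have "[x = y] (mod v)" by simp
    with xy show "x = y" using cong_v_imp_cong_k marks_incongruent by blast
  qed
  ultimately show ?thesis by (simp add: card_image card_X)
qed

lemma configuration_blocks: "configuration (k * w) k {0..<v} blocks"
  unfolding configuration_def
proof (intro conjI ballI impI)
  show "card {0..<v} = k * w" "card blocks = k * w"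
    unfolding blocks_def card_image[OF inj_on_translate] by (simp_all add: v_def nat_mult_distrib)
  show "blocks \<subseteq> Pow {0..<v}" using translate_subset by (auto simp: blocks_def)
  show "card B = k" if "B \<in> blocks" for B using that by (auto simp: blocks_def card_translate)
next
  fix p q assume "p \<in> {0..<v}" "q \<in> {0..<v}" "p \<noteq> q"
  with two_points_determine_shift
  have "\<forall>B\<in>{B \<in> blocks. p \<in> B \<and> q \<in> B}. \<forall>C\<in>{B \<in> blocks. p \<in> B \<and> q \<in> B}. B = C"
    unfolding blocks_def by blast
  then show "card {B \<in> blocks. p \<in> B \<and> q \<in> B} \<le> 1"
    by (simp add: card_le_Suc0_iff_eq blocks_def)
next
  fix p assume p: "p \<in> {0..<v}"
  have "{B \<in> blocks. p \<in> B} = translate ` {i \<in> {0..<v}. p \<in> translate i}"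
    unfolding blocks_def by blast
  moreover have "inj_on translate {i \<in> {0..<v}. p \<in> translate i}"
    using inj_on_translate by (rule inj_on_subset) blast
  ultimately show "card {B \<in> blocks. p \<in> B} = k"
    using card_shifts_through_point[OF p] by (simp add: card_image)
qed simp

section \<open>The resolution\<close>

text \<open>The \<open>k\<close> marks are incongruent modulo \<open>k\<close>, so by counting they meet every residue class.\<close>

lemma mark_in_residue_class: "\<exists>x\<in>X. [x = a] (mod int k)"
proof -
  have "inj_on (\<lambda>x. x mod int k) X"
    by (rule inj_onI) (simp add: marks_incongruent cong_def)
  then have "card ((\<lambda>x. x mod int k) ` X) = card {0..<int k}"
    by (simp add: card_image card_X)
  moreover have "(\<lambda>x. x mod int k) ` X \<subseteq> {0..<int k}" using k_pos by auto
  ultimately have "(\<lambda>x. x mod int k) ` X = {0..<int k}" by (intro card_subset_eq) auto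
  moreover have "a mod int k \<in> {0..<int k}" using k_pos by simp
  ultimately obtain x where "x \<in> X" "a mod int k = x mod int k" by blast
  then show ?thesis by (auto simp: cong_def)
qed

lemma residue_class_subset: "residue_class k v j \<subseteq> {0..<v}"
  by (auto simp: residue_class_def)

lemma residue_class_nonempty:
  assumes "j \<in> {0..<int k}"
  shows "residue_class k v j \<noteq> {}"
  using card_residue_class[OF k_pos assms, of w] w_pos unfolding v_def by auto

text \<open>If a point lies in two blocks of the class, the two marks that are moved to it are
  congruent modulo \<open>k\<close> and hence equal, so the shifts agree. A class \<open>j\<close> reaches the point \<open>p\<close>
  through the mark that is congruent to \<open>p - j\<close>.\<close>

lemma partition_on_parallel_class:
  assumes j: "j \<in> {0..<int k}"
  shows "partition_on {0..<v} (parallel_class j)"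
proof (rule partition_onI)
  show "\<Union> (parallel_class j) = {0..<v}"
  proof (intro equalityI subsetI)
    fix p assume p: "p \<in> {0..<v}"
    obtain x where x: "x \<in> X" "[x = p - j] (mod int k)" using mark_in_residue_class by blast
    define i where "i = (p - x) mod v"
    have "[p - x = p - (p - j)] (mod int k)" by (intro cong_diff cong_refl x)
    then have "i mod int k = j"
      using j by (simp add: i_def mod_mod_cancel[OF k_dvd_v] cong_def)
    then have "i \<in> residue_class k v j" using v_pos by (simp add: residue_class_def i_def)
    moreover have "p \<in> translate i"
      using p x by (intro mem_translateI[of _ x]) (auto simp: i_def cong_def mod_simps)
    ultimately show "p \<in> \<Union> (parallel_class j)" by (auto simp: parallel_class_def)
  qed (use translate_subset in \<open>unfold parallel_class_def, blast\<close>)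
next
  fix B C assume BC: "B \<in> parallel_class j" "C \<in> parallel_class j" "B \<noteq> C"
  then obtain i i' where i: "i \<in> residue_class k v j" "B = translate i"
    and i': "i' \<in> residue_class k v j" "C = translate i'"
    by (auto simp: parallel_class_def)
  show "disjnt B C"
  proof (rule ccontr)
    assume "\<not> disjnt B C"
    then obtain p where "p \<in> translate i" "p \<in> translate i'" using i i' by (auto simp: disjnt_def)
    then obtain x x' where x: "x \<in> X" "[p = x + i] (mod v)" and x': "x' \<in> X" "[p = x' + i'] (mod v)"
      by (metis mem_translateE)
    have shifts: "[x + i = x' + i'] (mod v)" using x x' by (metis cong_sym cong_trans)
    have "[i = i'] (mod int k)" using i i' by (simp add: residue_class_def cong_def)
    from cong_diff[OF cong_v_imp_cong_k[OF shifts] this] have "x = x'"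
      using x x' marks_incongruent by simp
    with shifts have "[i = i'] (mod v)" by (simp only: cong_add_lcancel)
    then have "i = i'" using i i' residue_class_subset cong_v_imp_eq by blast
    with i i' BC show False by simp
  qed
next
  show "{} \<notin> parallel_class j"
    using X_nonempty by (auto simp: parallel_class_def translate_def)
qed

lemma card_parallel_class:
  assumes "j \<in> {0..<int k}"
  shows "card (parallel_class j) = w"
  using card_residue_class[OF k_pos assms] inj_on_subset[OF inj_on_translate residue_class_subset]
  by (simp add: parallel_class_def card_image v_def)

text \<open>Since the blocks correspond to their shifts, the partition of the shifts into residue
  classes becomes a partition of the blocks.\<close>

lemma partition_on_resolution: "partition_on blocks resolution"
proof -
  have "partition_on blocks ((`) translate ` residue_class k v ` {0..<int k} - {{}})"
    unfolding blocks_def using partition_on_residue_classes[OF residue_class_nonempty k_pos]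
    by (intro partition_on_inj_image inj_on_translate)
  moreover have "(`) translate ` residue_class k v ` {0..<int k} - {{}} = resolution"
    using residue_class_nonempty by (auto simp: resolution_def parallel_class_def)
  ultimately show ?thesis by simp
qed

lemma card_resolution: "card resolution = k"
proof -
  have "inj_on parallel_class {0..<int k}"
  proof (rule inj_onI)
    fix i j assume ij: "i \<in> {0..<int k}" "j \<in> {0..<int k}" "parallel_class i = parallel_class j"
    then have "residue_class k v i = residue_class k v j"
      using inj_on_image_eq_iff[OF inj_on_translate residue_class_subset residue_class_subset]
      by (simp add: parallel_class_def)
    with residue_class_nonempty[OF ij(1)] show "i = j" by (auto simp: residue_class_def)
  qed
  then show ?thesis by (simp add: resolution_def card_image)
qed

section \<open>Cyclic symmetry\<close>

lemma succ_translate: "(\<lambda>x. (x + 1) mod v) ` translate i = translate ((i + 1) mod v)"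
  by (simp add: translate_def image_image mod_simps add.assoc)

lemma succ_parallel_class:
  assumes "j \<in> {0..<int k}"
  shows "(`) (\<lambda>x. (x + 1) mod v) ` parallel_class j = parallel_class ((j + 1) mod int k)"
proof -
  have "(`) (\<lambda>x. (x + 1) mod v) ` parallel_class j
      = translate ` (\<lambda>i. (i + 1) mod v) ` residue_class k v j"
    by (simp add: parallel_class_def image_image succ_translate)
  then show ?thesis
    using succ_mod_image_residue_class[OF k_pos v_pos k_dvd_v assms] by (simp add: parallel_class_def)
qed

lemma succ_resolution: "(`) ((`) (\<lambda>x. (x + 1) mod v)) ` resolution = resolution"
proof -
  have "(`) ((`) (\<lambda>x. (x + 1) mod v)) ` resolution
      = parallel_class ` (\<lambda>j. (j + 1) mod int k) ` {0..<int k}"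
    unfolding resolution_def image_image by (intro image_cong refl) (simp only: succ_parallel_class)
  then show ?thesis using succ_mod_image[of "int k"] k_pos by (simp add: resolution_def)
qed

theorem cyclic_resolvable_configuration_translates:
  "cyclic_resolvable_configuration (k * w) k {0..<v} blocks resolution"
  unfolding cyclic_resolvable_configuration_def
proof (intro conjI exI[of _ "\<lambda>x. x"])
  show "resolvable_configuration (k * w) k {0..<v} blocks resolution"
    using configuration_blocks partition_on_resolution card_resolution k_pos
      card_parallel_class partition_on_parallel_class
    by (auto simp: resolvable_configuration_def resolution_def)
  show "bij_betw (\<lambda>x. x) {0..<v} {0..<int (k * w)}"
    by (simp add: v_def bij_betw_def)
  show "let \<R>' = (`) ((`) ((`) (\<lambda>x. x))) resolution
        in (`) ((`) ((`) (\<lambda>x. (x + 1) mod int (k * w)))) \<R>' = \<R>'"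
    using succ_resolution by (simp add: v_def)
qed

end

theorem corollary4p5:
  fixes k L :: nat
  assumes "\<exists>X. RGR k L X"
  shows "\<forall>w::nat. 0 < w \<and> k * w \<ge> 2 * L + 1 \<longrightarrow>
    (\<exists>(V :: int set) \<B> \<R>. cyclic_resolvable_configuration (k * w) k V \<B> \<R>)"
proof (intro allI impI)
  fix w :: nat assume w: "0 < w \<and> k * w \<ge> 2 * L + 1"
  obtain X where X: "RGR k L X" using assms by blast
  have v: "2 * int L + 1 \<le> int (k * w)" using w by linarith
  interpret modular_resolvable_ruler k w X
  proof
    show "x = x'" if "x \<in> X" "y \<in> X" "x' \<in> X" "y' \<in> X" "x \<noteq> y"
      "[y - x = y' - x'] (mod int (k * w))" for x y x' y'
      using Golomb_difference_mod_unique[OF X v that] .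
    show "x = y" if "x \<in> X" "y \<in> X" "[x = y] (mod int k)" for x y
    proof (rule ccontr)
      assume "x \<noteq> y"
      moreover have "[x - y = 0] (mod int k)"
        using that(3) by (simp add: cong_iff_dvd_diff)
      ultimately show False
        using X that(1,2) by (auto simp: RGR_def resolvable_ruler_def)
    qed
  qed (use X w in \<open>simp_all add: RGR_def golomb_ruler_def\<close>)
  show "\<exists>(V :: int set) \<B> \<R>. cyclic_resolvable_configuration (k * w) k V \<B> \<R>"
    using cyclic_resolvable_configuration_translates by blast
qed

end
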